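(* Let $k=\mathbb{Q}[y,y^{-1}]$ and let $V$ be the free $k$-module with basis $e_1,e_2$. Let $R:V\otimes V\to V\otimes V$ be the $k$-linear map whose matrix with respect to the ordered basis $e_1\otimes e_1,\ e_1\otimes e_2,\ e_2\otimes e_1,\ e_2\otimes e_2$ is $$\begin{pmatrix}1&0&0&0\\0&1-y^2&1&0\\0&y^2&0&0\\0&0&0&1\end{pmatrix}.$$ Let $\alpha:V\otimes V\to k$ and $\beta:k\to V\otimes V$ be the $k$-linear maps defined by $$\alpha(e_1\otimes e_1)=\alpha(e_2\otimes e_2)=0,\quad \alpha(e_1\otimes e_2)=-y,\quad \alpha(e_2\otimes e_1)=y^{-1},\quad \beta(1)=y(e_1\otimes e_2-e_2\otimes e_1).$$ Then $R=I+J$, where $I$ is the identity of $V\otimes V$ and $J=\beta\circ\alpha$.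
   Context: Tensor products are over $k$. Matrices act on column vectors, so the columns of the matrix of $R$ are the images of the basis vectors; e.g. $R(e_1\otimes e_2)=(1-y^2)\,e_1\otimes e_2+y^2\,e_2\otimes e_1$ and $R(e_2\otimes e_1)=e_1\otimes e_2$. *)

theory Defs
  imports "HOL-Analysis.Analysis" "HOL-Library.Poly_Mapping"
begin

text \<open>Finitely supported functions on the integers with the convolution product of
  \<^theory>\<open>HOL-Library.Poly_Mapping\<close>; the value at \<open>n\<close> is the coefficient of the
  \<open>n\<close>-th power of \<open>Y\<close>.\<close>

type_synonym laurent = "int \<Rightarrow>\<^sub>0 rat"

definition Y :: laurent
  where "Y = Poly_Mapping.single 1 1"

definition Y_inv :: laurent
  where "Y_inv = Poly_Mapping.single (- 1) 1"

lemma Y_mult_Y_inv: "Y * Y_inv = 1"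
  by (simp add: Y_def Y_inv_def mult_single)

class laurent_module = ab_group_add +
  fixes lscale :: "laurent \<Rightarrow> 'a \<Rightarrow> 'a" (infixr \<open>*\<^sub>k\<close> 75)
  assumes lscale_add_right: "a *\<^sub>k (v + w) = a *\<^sub>k v + a *\<^sub>k w"
    and lscale_add_left: "(a + b) *\<^sub>k v = a *\<^sub>k v + b *\<^sub>k v"
    and lscale_lscale: "a *\<^sub>k (b *\<^sub>k v) = (a * b) *\<^sub>k v"
    and lscale_one: "1 *\<^sub>k v = v"

interpretation laurent_module: module "lscale :: laurent \<Rightarrow> 'a \<Rightarrow> 'a::laurent_module"
  by unfold_locales (simp_all add: lscale_add_right lscale_add_left lscale_lscale lscale_one)

interpretation laurent_self: module "(*) :: laurent \<Rightarrow> laurent \<Rightarrow> laurent"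
  by unfold_locales (simp_all add: algebra_simps)

definition ordered_basis :: "'v::laurent_module ^ 'n \<Rightarrow> bool"
  where "ordered_basis b \<longleftrightarrow>
    inj (($) b) \<and> laurent_module.independent (range (($) b)) \<and>
    laurent_module.span (range (($) b)) = UNIV"

text \<open>Column convention: the \<open>j\<close>-th column of the matrix consists of the coordinates of the
  image of the \<open>j\<close>-th basis vector.\<close>

definition has_matrix ::
    "('v::laurent_module \<Rightarrow> 'v) \<Rightarrow> 'v ^ 'n \<Rightarrow> laurent ^ 'n ^ 'n \<Rightarrow> bool"
  where "has_matrix f b M \<longleftrightarrow> (\<forall>j. f (b $ j) = (\<Sum>i\<in>UNIV. M $ i $ j *\<^sub>k b $ i))"

lemma vector_4 [simp]:
  "(vector [a, b, c, d] :: 'a::zero ^ 4) $ 1 = a"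
  "(vector [a, b, c, d] :: 'a::zero ^ 4) $ 2 = b"
  "(vector [a, b, c, d] :: 'a::zero ^ 4) $ 3 = c"
  "(vector [a, b, c, d] :: 'a::zero ^ 4) $ 4 = d"
  unfolding vector_def by simp_all

text \<open>The quotient of the free module on the pairs by the submodule of bilinearity relations.\<close>

definition free_scale :: "laurent \<Rightarrow> ('a \<Rightarrow>\<^sub>0 laurent) \<Rightarrow> ('a \<Rightarrow>\<^sub>0 laurent)"
  where "free_scale c = Poly_Mapping.map ((*) c)"

lemma lookup_free_scale: "Poly_Mapping.lookup (free_scale c p) x = c * Poly_Mapping.lookup p x"
  by (auto simp: free_scale_def Poly_Mapping.map.rep_eq when_def)

lemma free_scale_module: "module (free_scale :: laurent \<Rightarrow> ('a \<Rightarrow>\<^sub>0 laurent) \<Rightarrow> _)"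
proof
  fix a b :: laurent and x y :: "'a \<Rightarrow>\<^sub>0 laurent"
  show "free_scale a (x + y) = free_scale a x + free_scale a y"
    by (rule poly_mapping_eqI) (simp only: lookup_free_scale lookup_add distrib_left)
  show "free_scale (a + b) x = free_scale a x + free_scale b x"
    by (rule poly_mapping_eqI) (simp only: lookup_free_scale lookup_add distrib_right)
  show "free_scale a (free_scale b x) = free_scale (a * b) x"
    by (rule poly_mapping_eqI) (simp only: lookup_free_scale mult.assoc)
  show "free_scale 1 x = x"
    by (rule poly_mapping_eqI) (simp only: lookup_free_scale mult_1_left)
qed

interpretation free_module: module "free_scale :: laurent \<Rightarrow> ('a \<Rightarrow>\<^sub>0 laurent) \<Rightarrow> _"
  by (rule free_scale_module)

abbreviation free_gen :: "'a \<Rightarrow> ('a \<Rightarrow>\<^sub>0 laurent)"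
  where "free_gen x \<equiv> Poly_Mapping.single x 1"

definition bilinear_relations :: "('v::laurent_module \<times> 'w::laurent_module \<Rightarrow>\<^sub>0 laurent) set"
  where "bilinear_relations =
    {free_gen (v + v', w) - free_gen (v, w) - free_gen (v', w) | v v' w. True} \<union>
    {free_gen (v, w + w') - free_gen (v, w) - free_gen (v, w') | v w w'. True} \<union>
    {free_gen (c *\<^sub>k v, w) - free_scale c (free_gen (v, w)) | c v w. True} \<union>
    {free_gen (v, c *\<^sub>k w) - free_scale c (free_gen (v, w)) | c v w. True}"

definition tensor_rel ::
    "('v::laurent_module \<times> 'w::laurent_module \<Rightarrow>\<^sub>0 laurent) \<Rightarrow>
     ('v \<times> 'w \<Rightarrow>\<^sub>0 laurent) \<Rightarrow> bool"
  where "tensor_rel p q \<longleftrightarrow> p - q \<in> free_module.span bilinear_relations"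

lemma equivp_tensor_rel:
  "equivp (tensor_rel :: ('v::laurent_module \<times> 'w::laurent_module \<Rightarrow>\<^sub>0 laurent) \<Rightarrow> _)"
  (is "equivp ?rel")
proof (rule equivpI)
  show "reflp ?rel"
    by (simp add: reflp_def tensor_rel_def free_module.span_zero)
  show "symp ?rel"
  proof (rule sympI)
    fix p q :: "'v \<times> 'w \<Rightarrow>\<^sub>0 laurent"
    assume "tensor_rel p q"
    then show "tensor_rel q p"
      unfolding tensor_rel_def using free_module.span_neg by fastforce
  qed
  show "transp ?rel"
  proof (rule transpI)
    fix p q r :: "'v \<times> 'w \<Rightarrow>\<^sub>0 laurent"
    assume "tensor_rel p q" "tensor_rel q r"
    then show "tensor_rel p r"
      unfolding tensor_rel_def using free_module.span_add by fastforce
  qed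
qed

lemma diff_diff_swap: "(a - b) - (c - d) = (a - c) - (b - d)" for a :: "'a::ab_group_add"
  by simp

quotient_type (overloaded) ('v, 'w) tensor =
  "'v::laurent_module \<times> 'w::laurent_module \<Rightarrow>\<^sub>0 laurent" / tensor_rel
  by (rule equivp_tensor_rel)

instantiation tensor :: (laurent_module, laurent_module) laurent_module
begin

lift_definition zero_tensor :: "('a, 'b) tensor" is 0 .

lift_definition plus_tensor :: "('a, 'b) tensor \<Rightarrow> ('a, 'b) tensor \<Rightarrow> ('a, 'b) tensor" is "(+)"
  unfolding tensor_rel_def
  by (simp only: add_diff_add free_module.span_add)

lift_definition uminus_tensor :: "('a, 'b) tensor \<Rightarrow> ('a, 'b) tensor" is uminus
  unfolding tensor_rel_def
  by (simp only: minus_diff_minus free_module.span_neg)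

lift_definition minus_tensor :: "('a, 'b) tensor \<Rightarrow> ('a, 'b) tensor \<Rightarrow> ('a, 'b) tensor" is "(-)"
  unfolding tensor_rel_def
  by (subst diff_diff_swap) (rule free_module.span_diff)

lift_definition lscale_tensor :: "laurent \<Rightarrow> ('a, 'b) tensor \<Rightarrow> ('a, 'b) tensor" is free_scale
  unfolding tensor_rel_def
  by (simp only: free_module.scale_right_diff_distrib[symmetric] free_module.span_scale)

instance
proof
  fix s t u :: "('a, 'b) tensor" and c d :: laurent
  have eq: "tensor_rel p q" if "p = q" for p q :: "'a \<times> 'b \<Rightarrow>\<^sub>0 laurent"
    using that by (simp add: tensor_rel_def free_module.span_zero)
  show "s + t + u = s + (t + u)" by transfer (rule eq, simp)
  show "s + t = t + s" by transfer (rule eq, simp)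
  show "0 + s = s" by transfer (rule eq, simp)
  show "- s + s = 0" by transfer (rule eq, simp)
  show "s - t = s + - t" by transfer (rule eq, simp)
  show "c *\<^sub>k (s + t) = c *\<^sub>k s + c *\<^sub>k t"
    by transfer (rule eq, rule free_module.scale_right_distrib)
  show "(c + d) *\<^sub>k s = c *\<^sub>k s + d *\<^sub>k s"
    by transfer (rule eq, rule free_module.scale_left_distrib)
  show "c *\<^sub>k d *\<^sub>k s = (c * d) *\<^sub>k s" by transfer (rule eq, simp)
  show "1 *\<^sub>k s = s" by transfer (rule eq, simp)
qed

end

lift_definition tensor_of ::
  "'v::laurent_module \<Rightarrow> 'w::laurent_module \<Rightarrow> ('v, 'w) tensor" (infixr \<open>\<otimes>\<close> 76)
  is "\<lambda>v w. free_gen (v, w)" .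

lemma tensor_add_left: "(v + v') \<otimes> w = v \<otimes> w + v' \<otimes> w"
  by transfer (unfold tensor_rel_def diff_diff_eq[symmetric],
    rule free_module.span_base, unfold bilinear_relations_def, blast)

lemma tensor_add_right: "v \<otimes> (w + w') = v \<otimes> w + v \<otimes> w'"
  by transfer (unfold tensor_rel_def diff_diff_eq[symmetric],
    rule free_module.span_base, unfold bilinear_relations_def, blast)

lemma tensor_scale_left: "(c *\<^sub>k v) \<otimes> w = c *\<^sub>k (v \<otimes> w)"
  by transfer (unfold tensor_rel_def diff_diff_eq[symmetric],
    rule free_module.span_base, unfold bilinear_relations_def, blast)

lemma tensor_scale_right: "v \<otimes> (c *\<^sub>k w) = c *\<^sub>k (v \<otimes> w)"
  by transfer (unfold tensor_rel_def diff_diff_eq[symmetric],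
    rule free_module.span_base, unfold bilinear_relations_def, blast)

text \<open>The universal property: bilinear maps on the pairs correspond to linear maps on the tensor
  product.\<close>

definition bilinear_map ::
    "(laurent \<Rightarrow> 'm \<Rightarrow> 'm::ab_group_add) \<Rightarrow>
     ('v::laurent_module \<Rightarrow> 'w::laurent_module \<Rightarrow> 'm) \<Rightarrow> bool"
  where "bilinear_map s f \<longleftrightarrow>
    (\<forall>w. module_hom lscale s (\<lambda>v. f v w)) \<and> (\<forall>v. module_hom lscale s (f v))"

definition free_extend ::
    "(laurent \<Rightarrow> 'm \<Rightarrow> 'm::ab_group_add) \<Rightarrow> ('a \<Rightarrow> 'm) \<Rightarrow> ('a \<Rightarrow>\<^sub>0 laurent) \<Rightarrow> 'm"
  where "free_extend s f p = (\<Sum>x\<in>Poly_Mapping.keys p. s (Poly_Mapping.lookup p x) (f x))"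

lemma module_hom_free_extend:
  assumes "module s"
  shows "module_hom free_scale s (free_extend s (f :: 'a \<Rightarrow> _))"
proof -
  interpret s: module s by fact
  have ext: "free_extend s f p = (\<Sum>x\<in>A. s (Poly_Mapping.lookup p x) (f x))"
    if "finite A" "Poly_Mapping.keys p \<subseteq> A" for p A
    unfolding free_extend_def using that
    by (intro sum.mono_neutral_left) (auto simp: in_keys_iff)
  show ?thesis
  proof (intro module_hom.intro module_hom_axioms.intro free_scale_module assms)
    fix p q :: "'a \<Rightarrow>\<^sub>0 laurent" and c :: laurent
    define A where "A = Poly_Mapping.keys p \<union> Poly_Mapping.keys q"
    have A: "finite A" "Poly_Mapping.keys p \<subseteq> A" "Poly_Mapping.keys q \<subseteq> A"
      "Poly_Mapping.keys (p + q) \<subseteq> A"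
      unfolding A_def using Poly_Mapping.keys_add[of p q] by auto
    show "free_extend s f (p + q) = free_extend s f p + free_extend s f q"
      unfolding ext[OF A(1,2)] ext[OF A(1,3)] ext[OF A(1,4)]
      by (simp only: lookup_add s.scale_left_distrib sum.distrib)
    have B: "Poly_Mapping.keys (free_scale c p) \<subseteq> A"
      using A(2) by (auto simp: in_keys_iff lookup_free_scale)
    show "free_extend s f (free_scale c p) = s c (free_extend s f p)"
      unfolding ext[OF A(1,2)] ext[OF A(1) B]
      by (simp only: lookup_free_scale s.scale_scale[symmetric] s.scale_sum_right)
  qed
qed

lemma free_extend_gen:
  assumes "module s"
  shows "free_extend s f (free_gen x) = f x"
  by (simp add: free_extend_def module.scale_one[OF assms])

lemma free_span_gens: "free_module.span (range free_gen) = UNIV"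
proof -
  have "p \<in> free_module.span (range free_gen)" for p :: "'a \<Rightarrow>\<^sub>0 laurent"
  proof -
    have "p = (\<Sum>x\<in>Poly_Mapping.keys p. free_scale (Poly_Mapping.lookup p x) (free_gen x))"
    proof (rule poly_mapping_eqI)
      fix z
      show "Poly_Mapping.lookup p z = Poly_Mapping.lookup
          (\<Sum>x\<in>Poly_Mapping.keys p. free_scale (Poly_Mapping.lookup p x) (free_gen x)) z"
        by (cases "z \<in> Poly_Mapping.keys p")
          (auto simp: lookup_sum lookup_free_scale lookup_single when_def in_keys_iff if_distrib
            sum.delta cong: if_cong)
    qed
    also have "\<dots> \<in> free_module.span (range free_gen)"
      by (intro free_module.span_sum free_module.span_scale free_module.span_base) simp
    finally show ?thesis .
  qed
  then show ?thesis by auto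
qed

lemma module_hom_abs_tensor: "module_hom free_scale lscale abs_tensor"
  by (intro module_hom.intro module_hom_axioms.intro free_scale_module
      laurent_module.module_axioms) (simp_all only: plus_tensor.abs_eq lscale_tensor.abs_eq)

lemma tensor_span: "laurent_module.span {v \<otimes> w | v w. True} = UNIV"
proof -
  interpret abs: module_hom free_scale lscale "abs_tensor :: _ \<Rightarrow> ('a, 'b) tensor"
    by (rule module_hom_abs_tensor)
  have "t \<in> laurent_module.span {v \<otimes> w | v w. True}" for t :: "('a, 'b) tensor"
  proof (induction t rule: tensor.abs_induct)
    case (1 p)
    have "p \<in> free_module.span (range free_gen)"
      by (simp add: free_span_gens)
    then show ?case
    proof (induction rule: free_module.span_induct_alt)
      case base
      show ?case by (simp only: abs.zero laurent_module.span_zero)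
    next
      case (step c x q)
      from step(1) obtain v w where "x = free_gen (v, w)" by auto
      then have "abs_tensor x = v \<otimes> w" by (simp add: tensor_of.abs_eq)
      then have "abs_tensor x \<in> laurent_module.span {v \<otimes> w | v w. True}"
        by (auto intro: laurent_module.span_base)
      with step(2) show ?case
        by (simp only: abs.add abs.scale laurent_module.span_add laurent_module.span_scale)
    qed
  qed
  then show ?thesis by blast
qed

theorem tensor_universal:
  fixes f :: "'v::laurent_module \<Rightarrow> 'w::laurent_module \<Rightarrow> 'm::ab_group_add"
  assumes s: "module s" and f: "bilinear_map s f"
  shows "\<exists>!g. module_hom lscale s g \<and> (\<forall>v w. g (v \<otimes> w) = f v w)"
proof (rule ex_ex1I)
  interpret s: module s by fact
  define E where "E = free_extend s (case_prod f)"
  interpret E: module_hom free_scale s E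
    unfolding E_def using s by (rule module_hom_free_extend)
  have gen: "E (free_gen (v, w)) = f v w" for v w
    by (simp add: E_def free_extend_gen[OF s])
  have bil: "f (v + v') w = f v w + f v' w" "f v (w + w') = f v w + f v w'"
    "f (c *\<^sub>k v) w = s c (f v w)" "f v (c *\<^sub>k w) = s c (f v w)" for c v v' w w'
    using f by (auto simp: bilinear_map_def module_hom_iff)
  have ker: "E r = 0" if "r \<in> free_module.span bilinear_relations" for r
    using that
  proof (rule E.eq_0_on_span[rotated])
    fix x :: "'v \<times> 'w \<Rightarrow>\<^sub>0 laurent"
    assume "x \<in> bilinear_relations"
    then show "E x = 0"
      unfolding bilinear_relations_def
      by (auto simp only: E.diff E.scale gen bil Un_iff mem_Collect_eq) auto
  qed
  define g where "g t = E (rep_tensor t)" for t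
  have g: "g (abs_tensor p) = E p" for p
  proof -
    have "tensor_rel (rep_tensor (abs_tensor p)) p"
      by (rule Quotient3_rep_abs[OF Quotient3_tensor]) (simp add: equivp_reflp[OF equivp_tensor_rel])
    then have "E (rep_tensor (abs_tensor p) - p) = 0"
      unfolding tensor_rel_def by (rule ker)
    then show ?thesis by (simp add: g_def E.diff)
  qed
  have "g (t + u) = g t + g u" for t u
    by (induction t rule: tensor.abs_induct; induction u rule: tensor.abs_induct)
      (simp only: plus_tensor.abs_eq g E.add)
  moreover have "g (c *\<^sub>k t) = s c (g t)" for c t
    by (induction t rule: tensor.abs_induct) (simp only: lscale_tensor.abs_eq g E.scale)
  moreover have "g (v \<otimes> w) = f v w" for v w
    by (simp only: tensor_of.abs_eq g gen)
  ultimately show "\<exists>g. module_hom lscale s g \<and> (\<forall>v w. g (v \<otimes> w) = f v w)"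
    using s laurent_module.module_axioms
    by (intro exI[of _ g] conjI module_hom.intro module_hom_axioms.intro) auto
next
  fix g h :: "('v, 'w) tensor \<Rightarrow> 'm"
  assume g: "module_hom lscale s g \<and> (\<forall>v w. g (v \<otimes> w) = f v w)"
    and h: "module_hom lscale s h \<and> (\<forall>v w. h (v \<otimes> w) = f v w)"
  have pair: "module_pair (lscale :: laurent \<Rightarrow> ('v, 'w) tensor \<Rightarrow> _) s"
    by (intro module_pair.intro laurent_module.module_axioms s)
  show "g = h"
  proof
    fix t :: "('v, 'w) tensor"
    have "t \<in> laurent_module.span {v \<otimes> w | v w. True}"
      unfolding tensor_span by (rule UNIV_I)
    then show "g t = h t"
      by (rule module_pair.module_hom_eq_on_span[OF pair conjunct1[OF g] conjunct1[OF h], rotated])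
        (use g h in auto)
  qed
qed

lemma dual_functional:
  assumes "ordered_basis b"
  obtains \<phi> where "module_hom lscale (*) \<phi>" "\<And>i. \<phi> (b $ i) = (if i = j then 1 else 0)"
proof
  have b: "laurent_module.independent (range (($) b))" "inj (($) b)"
    "\<And>v. v \<in> laurent_module.span (range (($) b))"
    using assms by (auto simp: ordered_basis_def)
  let ?r = "laurent_module.representation (range (($) b))"
  show "module_hom lscale (*) (\<lambda>v. ?r v (b $ j))"
    by (intro module_hom.intro module_hom_axioms.intro
        laurent_module.module_axioms laurent_self.module_axioms)
      (simp_all only: laurent_module.representation_add[OF b(1) b(3) b(3)]
        laurent_module.representation_scale[OF b(1) b(3)])
  show "?r (b $ i) (b $ j) = (if i = j then 1 else 0)" for i
    using laurent_module.representation_basis[OF b(1), of "b $ i"] injD[OF b(2), of i j] by auto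
qed

lemma ordered_basis_dualI:
  fixes b :: "'v::laurent_module ^ 'n"
  assumes dual: "\<And>j. \<exists>\<phi>. module_hom lscale (*) \<phi> \<and> (\<forall>i. \<phi> (b $ i) = (if i = j then 1 else 0))"
    and span: "laurent_module.span (range (($) b)) = UNIV"
  shows "ordered_basis b"
proof -
  obtain \<phi> where hom: "\<And>j. module_hom lscale (*) (\<phi> j)"
    and \<phi>: "\<And>i j. \<phi> j (b $ i) = (if i = j then 1 else 0)"
    using dual by metis
  have inj: "inj (($) b)"
    by (rule injI) (metis \<phi> zero_neq_one)
  have "u (b $ j) = 0" if u: "(\<Sum>i\<in>UNIV. u (b $ i) *\<^sub>k b $ i) = 0" for u j
  proof -
    interpret j: module_hom lscale "(*)" "\<phi> j" by (rule hom)
    have "(\<Sum>i\<in>UNIV. u (b $ i) * \<phi> j (b $ i)) = \<phi> j (\<Sum>i\<in>UNIV. u (b $ i) *\<^sub>k b $ i)"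
      by (simp only: j.sum j.scale)
    then show ?thesis using u by (simp add: \<phi> j.zero if_distrib cong: if_cong)
  qed
  then have "laurent_module.independent (range (($) b))"
    by (subst laurent_module.dependent_finite) (auto simp: sum.reindex[OF inj])
  with inj span show ?thesis by (simp add: ordered_basis_def)
qed

lemma module_hom_mult_left:
  assumes "module_hom lscale (*) \<phi>"
  shows "module_hom lscale (*) (\<lambda>v. a * \<phi> v)"
  by (intro module_hom.intro module_hom_axioms.intro
      laurent_module.module_axioms laurent_self.module_axioms)
    (simp_all only: module_hom.add[OF assms] module_hom.scale[OF assms]
      distrib_left mult.left_commute)

lemma module_hom_mult_right:
  assumes "module_hom lscale (*) \<phi>"
  shows "module_hom lscale (*) (\<lambda>v. \<phi> v * a)"
  using module_hom_mult_left[OF assms, of a] by (simp only: mult.commute)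

lemma ordered_basis_tensor:
  fixes e\<^sub>1 e\<^sub>2 :: "'v::laurent_module"
  assumes "ordered_basis (vector [e\<^sub>1, e\<^sub>2] :: 'v ^ 2)"
  shows "ordered_basis
    (vector [e\<^sub>1 \<otimes> e\<^sub>1, e\<^sub>1 \<otimes> e\<^sub>2, e\<^sub>2 \<otimes> e\<^sub>1, e\<^sub>2 \<otimes> e\<^sub>2] :: ('v, 'v) tensor ^ 4)"
    (is "ordered_basis ?B")
proof (rule ordered_basis_dualI)
  have "\<exists>p. module_hom lscale (*) p \<and> p e\<^sub>1 = 1 \<and> p e\<^sub>2 = 0"
  proof (rule dual_functional[OF assms, of 1])
    fix p assume "module_hom lscale (*) p"
      and p: "\<And>i. p ((vector [e\<^sub>1, e\<^sub>2] :: 'v ^ 2) $ i) = (if i = 1 then 1 else 0)"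
    with p[of 1] p[of 2] show ?thesis by auto
  qed
  then obtain p where p: "module_hom lscale (*) p" "p e\<^sub>1 = 1" "p e\<^sub>2 = 0" by blast
  have "\<exists>q. module_hom lscale (*) q \<and> q e\<^sub>1 = 0 \<and> q e\<^sub>2 = 1"
  proof (rule dual_functional[OF assms, of 2])
    fix q assume "module_hom lscale (*) q"
      and q: "\<And>i. q ((vector [e\<^sub>1, e\<^sub>2] :: 'v ^ 2) $ i) = (if i = 2 then 1 else 0)"
    with q[of 1] q[of 2] show ?thesis by auto
  qed
  then obtain q where q: "module_hom lscale (*) q" "q e\<^sub>1 = 0" "q e\<^sub>2 = 1" by blast
  have lift: "\<exists>g. module_hom lscale (*) g \<and> (\<forall>v w. g (v \<otimes> w) = f v * f' w)"
    if "module_hom lscale (*) f" "module_hom lscale (*) f'" for f f' :: "'v \<Rightarrow> laurent"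
    by (rule ex1_implies_ex, rule tensor_universal)
      (simp_all only: bilinear_map_def module_hom_mult_left module_hom_mult_right that
        laurent_self.module_axioms simp_thms)
  obtain g11 where g11: "module_hom lscale (*) g11" "\<And>v w. g11 (v \<otimes> w) = p v * p w"
    using lift[OF p(1) p(1)] by blast
  obtain g12 where g12: "module_hom lscale (*) g12" "\<And>v w. g12 (v \<otimes> w) = p v * q w"
    using lift[OF p(1) q(1)] by blast
  obtain g21 where g21: "module_hom lscale (*) g21" "\<And>v w. g21 (v \<otimes> w) = q v * p w"
    using lift[OF q(1) p(1)] by blast
  obtain g22 where g22: "module_hom lscale (*) g22" "\<And>v w. g22 (v \<otimes> w) = q v * q w"
    using lift[OF q(1) q(1)] by blast
  have "\<forall>j. \<exists>\<phi>. module_hom lscale (*) \<phi> \<and> (\<forall>i. \<phi> (?B $ i) = (if i = j then 1 else 0))"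
    unfolding forall_4
    apply (intro conjI)
       apply (rule exI[of _ g11], simp add: g11 p q)
      apply (rule exI[of _ g12], simp add: g12 p q)
     apply (rule exI[of _ g21], simp add: g21 p q)
    apply (rule exI[of _ g22], simp add: g22 p q)
    done
  then show "\<exists>\<phi>. module_hom lscale (*) \<phi> \<and> (\<forall>i. \<phi> (?B $ i) = (if i = j then 1 else 0))" for j
    by blast
  let ?S = "laurent_module.span (range (($) ?B))"
  have B: "?B $ i \<in> ?S" for i
    by (rule laurent_module.span_base) simp
  have B: "e\<^sub>1 \<otimes> e\<^sub>1 \<in> ?S" "e\<^sub>1 \<otimes> e\<^sub>2 \<in> ?S" "e\<^sub>2 \<otimes> e\<^sub>1 \<in> ?S" "e\<^sub>2 \<otimes> e\<^sub>2 \<in> ?S"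
    using B[of 1] B[of 2] B[of 3] B[of 4] by simp_all
  have exp: "\<exists>a b. v = a *\<^sub>k e\<^sub>1 + b *\<^sub>k e\<^sub>2" for v
  proof -
    have "range (($) (vector [e\<^sub>1, e\<^sub>2] :: 'v ^ 2)) = {e\<^sub>1, e\<^sub>2}"
      by (simp add: UNIV_2)
    then have "v \<in> laurent_module.span {e\<^sub>1, e\<^sub>2}"
      using assms by (simp add: ordered_basis_def)
    then obtain a b where "v - a *\<^sub>k e\<^sub>1 - b *\<^sub>k e\<^sub>2 = 0"
      by (auto simp: laurent_module.span_insert)
    then have "v = a *\<^sub>k e\<^sub>1 + b *\<^sub>k e\<^sub>2" by (simp add: diff_diff_eq)
    then show ?thesis by blast
  qed
  have "v \<otimes> w \<in> ?S" for v w
  proof -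
    obtain a b c d where "v = a *\<^sub>k e\<^sub>1 + b *\<^sub>k e\<^sub>2" "w = c *\<^sub>k e\<^sub>1 + d *\<^sub>k e\<^sub>2"
      using exp[of v] exp[of w] by blast
    then show ?thesis
      by (simp only: tensor_add_left tensor_add_right tensor_scale_left tensor_scale_right B
          laurent_module.span_add laurent_module.span_scale)
  qed
  then have "laurent_module.span {v \<otimes> w | v w. True} \<subseteq> ?S"
    by (intro laurent_module.span_minimal) auto
  then show "?S = UNIV"
    unfolding tensor_span by (rule top.extremum_uniqueI)
qed

end

theory Submission
  imports Defs
begin

text \<open>Both sides are \<open>laurent\<close>-linear, so it is enough to compare them on the
  four products of \<open>e\<^sub>1\<close> and \<open>e\<^sub>2\<close>, which span the tensor
  square by \<open>ordered_basis_tensor\<close>. Put u =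
  \<open>e\<^sub>1 \<otimes> e\<^sub>2\<close> and v = \<open>e\<^sub>2 \<otimes> e\<^sub>1\<close>.
  J kills the two diagonal products, which R fixes; J u = -Y^2 (u - v) = R u - u; and J v =
  \<open>Y_inv\<close> Y (u - v) = u - v = R v - v.\<close>

theorem lemma3p1:
  fixes e\<^sub>1 e\<^sub>2 :: "'v::laurent_module"
    and R :: "('v, 'v) tensor \<Rightarrow> ('v, 'v) tensor"
    and \<alpha> :: "('v, 'v) tensor \<Rightarrow> laurent"
    and \<beta> :: "laurent \<Rightarrow> ('v, 'v) tensor"
  assumes V_basis: "ordered_basis (vector [e\<^sub>1, e\<^sub>2] :: 'v ^ 2)"
    and R_linear: "module_hom lscale lscale R"
    and R_matrix: "has_matrix R
      (vector [e\<^sub>1 \<otimes> e\<^sub>1, e\<^sub>1 \<otimes> e\<^sub>2, e\<^sub>2 \<otimes> e\<^sub>1, e\<^sub>2 \<otimes> e\<^sub>2] :: ('v, 'v) tensor ^ 4)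
      (vector [vector [1, 0,       0, 0],
               vector [0, 1 - Y^2, 1, 0],
               vector [0, Y^2,     0, 0],
               vector [0, 0,       0, 1]])"
    and \<alpha>_linear: "module_hom lscale (*) \<alpha>"
    and \<alpha>_values: "\<alpha> (e\<^sub>1 \<otimes> e\<^sub>1) = 0" "\<alpha> (e\<^sub>2 \<otimes> e\<^sub>2) = 0"
      "\<alpha> (e\<^sub>1 \<otimes> e\<^sub>2) = - Y" "\<alpha> (e\<^sub>2 \<otimes> e\<^sub>1) = Y_inv"
    and \<beta>_linear: "module_hom (*) lscale \<beta>"
    and \<beta>_value: "\<beta> 1 = Y *\<^sub>k (e\<^sub>1 \<otimes> e\<^sub>2 - e\<^sub>2 \<otimes> e\<^sub>1)"
  shows "R = (\<lambda>t. id t + (\<beta> \<circ> \<alpha>) t)"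
proof
  interpret \<alpha>: module_hom lscale "(*)" \<alpha> by (rule \<alpha>_linear)
  interpret \<beta>: module_hom "(*)" lscale \<beta> by (rule \<beta>_linear)
  let ?B = "vector [e\<^sub>1 \<otimes> e\<^sub>1, e\<^sub>1 \<otimes> e\<^sub>2, e\<^sub>2 \<otimes> e\<^sub>1, e\<^sub>2 \<otimes> e\<^sub>2] :: ('v, 'v) tensor ^ 4"
  let ?S = "\<lambda>t. id t + (\<beta> \<circ> \<alpha>) t"
  fix t
  \<comment> \<open>Since c = c * 1, linearity reduces \<open>\<beta>\<close> to its value at 1. The
    scalar is distributed over the difference so that images can be compared coefficient by
    coefficient.\<close>
  have \<beta>: "\<beta> c = (c * Y) *\<^sub>k (e\<^sub>1 \<otimes> e\<^sub>2) - (c * Y) *\<^sub>k (e\<^sub>2 \<otimes> e\<^sub>1)" for c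
    using \<beta>.scale[of c 1]
    by (simp add: \<beta>_value laurent_module.scale_right_diff_distrib)
  \<comment> \<open>These are the columns of the matrix, read as images of the basis
    vectors.\<close>
  have R: "R (e\<^sub>1 \<otimes> e\<^sub>1) = e\<^sub>1 \<otimes> e\<^sub>1"
    "R (e\<^sub>1 \<otimes> e\<^sub>2) = (1 - Y\<^sup>2) *\<^sub>k (e\<^sub>1 \<otimes> e\<^sub>2) + Y\<^sup>2 *\<^sub>k (e\<^sub>2 \<otimes> e\<^sub>1)"
    "R (e\<^sub>2 \<otimes> e\<^sub>1) = e\<^sub>1 \<otimes> e\<^sub>2"
    "R (e\<^sub>2 \<otimes> e\<^sub>2) = e\<^sub>2 \<otimes> e\<^sub>2"
    using R_matrix by (simp_all add: has_matrix_def forall_4 sum_4)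
  have S_linear: "module_hom lscale lscale ?S"
    by (intro module_hom.intro module_hom_axioms.intro laurent_module.module_axioms)
      (simp_all add: \<alpha>.add \<alpha>.scale \<beta>.add \<beta>.scale lscale_add_right add_ac)
  \<comment> \<open>The relation \<open>Y * Y_inv = 1\<close> matters at
    \<open>e\<^sub>2 \<otimes> e\<^sub>1\<close>, where it turns the coefficients of J into 1 and
    -1; the latter cancels the identity term.\<close>
  have "\<forall>j. R (?B $ j) = ?S (?B $ j)"
    using Y_mult_Y_inv
    by (simp add: forall_4 R \<beta> \<alpha>_values power2_eq_square mult.commute
        laurent_module.scale_left_diff_distrib)
  then have eq_on_basis: "R x = ?S x" if "x \<in> range (($) ?B)" for x
    using that by blast
  have pair: "module_pair (lscale :: laurent \<Rightarrow> ('v, 'v) tensor \<Rightarrow> _)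
      (lscale :: laurent \<Rightarrow> ('v, 'v) tensor \<Rightarrow> _)"
    by (intro module_pair.intro laurent_module.module_axioms)
  \<comment> \<open>Spanning carries the agreement of the two linear maps from the basis to an
    arbitrary tensor \<open>t\<close>.\<close>
  have "t \<in> laurent_module.span (range (($) ?B))"
    using ordered_basis_tensor[OF V_basis] by (simp add: ordered_basis_def)
  with eq_on_basis show "R t = ?S t"
    by (rule module_pair.module_hom_eq_on_span[OF pair R_linear S_linear])
qed

end
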